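(* Let $k>1$. Then the graph $ST^2_k$ has an efficient coloring whose vertex color classes are the sets $\Sigma_i^k$, $i=1,\ldots,2k-1$: that is, there is a total coloring of $ST^2_k$ with the $2k-1$ colors $\{1,\ldots,2k-1\}$ in which each vertex of $\Sigma_i^k$ receives color $i$, and such that for every vertex $v$, the vertex $v$ together with its $2k-2$ neighbors receive pairwise distinct colors, thus all $2k-1$ colors.
   Context: $ST^2_k$ has as vertices all strings $v_0v_1\cdots v_{2k-1}$ over $\{0,\ldots,k-1\}$ in which each symbol occurs exactly twice; $v,w$ are adjacent iff $w$ arises from $v$ by swapping $v_0$ with some $v_j$ ($1\le j\le 2k-1$) with $v_j\neq v_0$. It is $(2k-2)$-regular. For $i\in\{1,\ldots,2k-1\}$, $\Sigma_i^k$ is the set of vertices $v$ with $v_i=v_0$. A total coloring assigns colors to vertices and edges so that adjacent vertices, edges sharing an endpoint, and an edge and its endpoints get different colors; for a $d$-regular graph, a total coloring with $d+1$ colors is efficient if each vertex and its neighbors receive all $d+1$ colors. *)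

theory Defs
  imports Main
begin

text \<open>Simple graphs are given by a vertex set and a set of two-element edges.\<close>

definition neighbors :: "'a set \<Rightarrow> 'a set set \<Rightarrow> 'a \<Rightarrow> 'a set" where
  "neighbors V E v = {w \<in> V. {v, w} \<in> E}"

definition regular_graph :: "'a set \<Rightarrow> 'a set set \<Rightarrow> nat \<Rightarrow> bool" where
  "regular_graph V E d \<longleftrightarrow> (\<forall>v\<in>V. finite (neighbors V E v) \<and> card (neighbors V E v) = d)"

definition total_coloring ::
  "'a set \<Rightarrow> 'a set set \<Rightarrow> 'c set \<Rightarrow> ('a \<Rightarrow> 'c) \<Rightarrow> ('a set \<Rightarrow> 'c) \<Rightarrow> bool" where
  "total_coloring V E C cv ce \<longleftrightarrow>
     (\<forall>v\<in>V. cv v \<in> C) \<and> (\<forall>e\<in>E. ce e \<in> C) \<and>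
     (\<forall>v\<in>V. \<forall>w\<in>V. {v, w} \<in> E \<longrightarrow> cv v \<noteq> cv w) \<and>
     (\<forall>e\<in>E. \<forall>f\<in>E. e \<noteq> f \<and> e \<inter> f \<noteq> {} \<longrightarrow> ce e \<noteq> ce f) \<and>
     (\<forall>e\<in>E. \<forall>v\<in>e. ce e \<noteq> cv v)"

definition efficient_coloring ::
  "'a set \<Rightarrow> 'a set set \<Rightarrow> nat \<Rightarrow> 'c set \<Rightarrow> ('a \<Rightarrow> 'c) \<Rightarrow> ('a set \<Rightarrow> 'c) \<Rightarrow> bool" where
  "efficient_coloring V E d C cv ce \<longleftrightarrow>
     regular_graph V E d \<and> finite C \<and> card C = d + 1 \<and>
     total_coloring V E C cv ce \<and>
     (\<forall>v\<in>V. cv ` insert v (neighbors V E v) = C)"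

definition ST2_verts :: "nat \<Rightarrow> nat list set" where
  "ST2_verts k = {v. length v = 2 * k \<and> set v \<subseteq> {..<k} \<and> (\<forall>s<k. count_list v s = 2)}"

definition ST2_adj :: "nat \<Rightarrow> nat list \<Rightarrow> nat list \<Rightarrow> bool" where
  "ST2_adj k v w \<longleftrightarrow> v \<in> ST2_verts k \<and>
     (\<exists>j\<in>{1..2 * k - 1}. v ! j \<noteq> v ! 0 \<and> w = v[0 := v ! j, j := v ! 0])"

definition ST2_edges :: "nat \<Rightarrow> nat list set set" where
  "ST2_edges k = {{v, w} | v w. v \<in> ST2_verts k \<and> w \<in> ST2_verts k \<and> ST2_adj k v w}"

definition Sigma_class :: "nat \<Rightarrow> nat \<Rightarrow> nat list set" where
  "Sigma_class k i = {v \<in> ST2_verts k. v ! i = v ! 0}"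

end

theory Submission
  imports Defs "HOL-Library.Multiset"
begin

text \<open>
  Reading a vertex v as a perfect matching of the positions (two positions are mates if they carry
  the same symbol), the class of v is the mate of position 0. Swapping the entries at 0 and j
  produces a vertex in which the mate of 0 is the former mate of j. Since taking mates is an
  involution, the neighbours of v receive each colour other than that of v exactly once. The edge
  given by a swap at position j is coloured j: this differs from the mates of 0 and of j, and it
  is the same colour seen from both ends.
\<close>

definition mate :: "'a list \<Rightarrow> nat \<Rightarrow> nat" where
  "mate v p = (THE q. q < length v \<and> q \<noteq> p \<and> v ! q = v ! p)"

definition swap0 :: "'a list \<Rightarrow> nat \<Rightarrow> 'a list" where
  "swap0 v j = v[0 := v ! j, j := v ! 0]"

definition swap_positions :: "'a list \<Rightarrow> nat set" where
  "swap_positions v = {j. 0 < j \<and> j < length v \<and> v ! j \<noteq> v ! 0}"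

text \<open>The ends of an edge differ exactly at 0 and at the swapped position, so excluding 0
  isolates the latter. Only the unordered pair enters, hence no end has to be singled out.\<close>

definition edge_position :: "'a list set \<Rightarrow> nat" where
  "edge_position e = (LEAST j. 0 < j \<and> (\<exists>v\<in>e. \<exists>w\<in>e. v ! j \<noteq> w ! j))"

section \<open>Swaps with position 0\<close>

lemma length_swap0 [simp]: "length (swap0 v j) = length v"
  by (simp add: swap0_def)

lemma nth_swap0:
  assumes "0 < j" "j < length v"
  shows "swap0 v j ! p = (if p = 0 then v ! j else if p = j then v ! 0 else v ! p)"
  using assms by (cases "p < length v") (auto simp: swap0_def nth_list_update)

lemma swap0_swap0:
  assumes "0 < j" "j < length v"
  shows "swap0 (swap0 v j) j = v"
  by (rule nth_equalityI) (use assms in \<open>auto simp: nth_swap0\<close>)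

lemma swap_positions_swap0:
  assumes "j \<in> swap_positions v"
  shows "j \<in> swap_positions (swap0 v j)"
  using assms by (auto simp: swap_positions_def nth_swap0)

lemma edge_position_swap0:
  assumes "j \<in> swap_positions v"
  shows "edge_position {v, swap0 v j} = j"
proof -
  have j: "0 < j" "j < length v" "v ! j \<noteq> v ! 0"
    using assms by (auto simp: swap_positions_def)
  show ?thesis
    unfolding edge_position_def
  proof (rule Least_equality)
    show "0 < j \<and> (\<exists>x\<in>{v, swap0 v j}. \<exists>w\<in>{v, swap0 v j}. x ! j \<noteq> w ! j)"
      using j by (auto simp: nth_swap0)
    show "j \<le> p" if "0 < p \<and> (\<exists>x\<in>{v, swap0 v j}. \<exists>w\<in>{v, swap0 v j}. x ! p \<noteq> w ! p)" for p
      using that j by (cases "p < j") (auto simp: nth_swap0)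
  qed
qed

lemma swap0_in_ST2_verts:
  assumes "v \<in> ST2_verts k" "j < length v"
  shows "swap0 v j \<in> ST2_verts k"
proof -
  have "0 < length v"
    using assms(2) by linarith
  \<comment> \<open>Being a vertex depends only on the multiset of entries, which a swap
    preserves.\<close>
  then have m: "mset (swap0 v j) = mset v"
    unfolding swap0_def using assms(2) by (intro mset_swap)
  have "set (swap0 v j) = set v"
    using m by (rule mset_eq_setD)
  moreover have "count_list (swap0 v j) s = count_list v s" for s
    using m by (metis count_mset)
  ultimately show ?thesis
    using assms(1) by (simp add: ST2_verts_def)
qed

section \<open>Mates as an involution on positions\<close>

lemma ex1_mate:
  assumes "v \<in> ST2_verts k" "p < 2 * k"
  shows "\<exists>!q. q < length v \<and> q \<noteq> p \<and> v ! q = v ! p"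
proof -
  have len: "length v = 2 * k"
    using assms by (simp add: ST2_verts_def)
  have "v ! p < k"
    using assms nth_mem[of p v] len by (auto simp: ST2_verts_def simp del: nth_mem)
  then have "count_list v (v ! p) = 2"
    using assms by (simp add: ST2_verts_def)
  \<comment> \<open>The symbol at \<open>p\<close> occupies two positions, so removing
    \<open>p\<close> leaves exactly one; this makes the definite description in \<open>mate\<close>
    meaningful.\<close>
  then have "card {q. q < length v \<and> v ! q = v ! p} = 2"
    by (simp add: count_list_eq_length_filter length_filter_conv_card eq_commute[of "v ! p"])
  moreover have "{q. q < length v \<and> q \<noteq> p \<and> v ! q = v ! p} = {q. q < length v \<and> v ! q = v ! p} - {p}"
    by auto
  ultimately have "card {q. q < length v \<and> q \<noteq> p \<and> v ! q = v ! p} = 1"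
    using assms len by simp
  then obtain r where "{q. q < length v \<and> q \<noteq> p \<and> v ! q = v ! p} = {r}"
    by (auto simp: card_1_singleton_iff)
  then show ?thesis
    by (auto simp: set_eq_iff)
qed

lemma
  assumes "v \<in> ST2_verts k" "p < 2 * k"
  shows mate_less: "mate v p < 2 * k"
    and mate_neq: "mate v p \<noteq> p"
    and nth_mate: "v ! mate v p = v ! p"
proof -
  have "length v = 2 * k"
    using assms(1) by (simp add: ST2_verts_def)
  then show "mate v p < 2 * k" "mate v p \<noteq> p" "v ! mate v p = v ! p"
    using theI'[OF ex1_mate[OF assms], folded mate_def] by simp_all
qed

lemma mate_eqI:
  assumes "v \<in> ST2_verts k" "p < 2 * k" "q < 2 * k" "q \<noteq> p" "v ! q = v ! p"
  shows "mate v p = q"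
  unfolding mate_def
  by (rule the1_equality[OF ex1_mate[OF assms(1,2)]]) (use assms in \<open>auto simp: ST2_verts_def\<close>)

lemma mate_mate:
  assumes "v \<in> ST2_verts k" "p < 2 * k"
  shows "mate v (mate v p) = p"
  using mate_eqI[OF assms(1) mate_less[OF assms] assms(2)] mate_neq[OF assms] nth_mate[OF assms]
  by simp

text \<open>Among the positive positions only the mate of 0 repeats the symbol at 0. The same set
  thus serves as the colours of the edges at \<open>v\<close> and, by
  \<open>bij_betw_color_neighbors\<close>, as the colours of its neighbours.\<close>

lemma swap_positions_eq_mate:
  assumes "v \<in> ST2_verts k" "k > 0"
  shows "swap_positions v = {1..2 * k - 1} - {mate v 0}"
proof -
  have "length v = 2 * k"
    using assms by (simp add: ST2_verts_def)
  moreover have "v ! j = v ! 0 \<longleftrightarrow> j = mate v 0" if "0 < j" "j < 2 * k" for j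
    using that assms mate_eqI[of v k 0 j] nth_mate[of v k 0] by auto
  ultimately show ?thesis
    using assms by (auto simp: swap_positions_def)
qed

text \<open>The symbol brought to the front is \<open>v ! j\<close>. Its other occurrence in
  \<open>v\<close> is at neither 0 nor \<open>j\<close>, so the swap leaves it in place.\<close>

lemma mate_swap0:
  assumes "v \<in> ST2_verts k" "j \<in> swap_positions v"
  shows "mate (swap0 v j) 0 = mate v j"
proof -
  have j: "0 < j" "j < 2 * k" "v ! j \<noteq> v ! 0" and len: "length v = 2 * k"
    using assms by (auto simp: swap_positions_def ST2_verts_def)
  have m: "mate v j < 2 * k" "mate v j \<noteq> j" "v ! mate v j = v ! j"
    using assms j mate_less mate_neq nth_mate by blast+
  \<comment> \<open>Otherwise 0 and \<open>j\<close> would carry the same symbol, and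
    \<open>j\<close> would not be a swap position.\<close>
  then have "mate v j \<noteq> 0"
    using j by metis
  then show ?thesis
    using assms j len m by (intro mate_eqI[of _ k]) (auto simp: swap0_in_ST2_verts nth_swap0)
qed

text \<open>The involution exchanges 0 and \<open>mate v 0\<close>, so it preserves the set of the
  remaining positions and is its own inverse there.\<close>

lemma bij_betw_mate:
  assumes "v \<in> ST2_verts k" "k > 0"
  shows "bij_betw (mate v) ({1..2 * k - 1} - {mate v 0}) ({1..2 * k - 1} - {mate v 0})"
proof -
  have in_range: "mate v p \<in> {1..2 * k - 1} - {mate v 0}" if "p \<in> {1..2 * k - 1} - {mate v 0}" for p
  proof -
    have p: "p < 2 * k" "p \<noteq> 0" "p \<noteq> mate v 0"
      using that by auto
    have "mate v (mate v p) = p" "mate v (mate v 0) = 0"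
      using mate_mate[OF assms(1)] p assms(2) by simp_all
    then have "mate v p \<noteq> 0" "mate v p \<noteq> mate v 0"
      using p by metis+
    then show ?thesis
      using mate_less[OF assms(1) p(1)] by auto
  qed
  then have "mate v ` ({1..2 * k - 1} - {mate v 0}) \<subseteq> {1..2 * k - 1} - {mate v 0}"
    by (rule image_subsetI)
  moreover have "\<forall>p\<in>{1..2 * k - 1} - {mate v 0}. mate v (mate v p) = p"
    using mate_mate[OF assms(1)] by auto
  ultimately show ?thesis
    by (intro bij_betw_byWitness[where f' = "mate v"])
qed

section \<open>Edges, neighbourhoods and the colours of neighbours\<close>

lemma ST2_edgeE:
  assumes "e \<in> ST2_edges k" "v \<in> e"
  obtains j where "v \<in> ST2_verts k" "j \<in> swap_positions v" "e = {v, swap0 v j}"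
proof -
  obtain x w where x: "x \<in> ST2_verts k" "w \<in> ST2_verts k" "e = {x, w}" and "ST2_adj k x w"
    using assms(1) unfolding ST2_edges_def by blast
  then obtain j where "j \<in> {1..2 * k - 1}" "x ! j \<noteq> x ! 0" and "w = swap0 x j"
    unfolding ST2_adj_def swap0_def by blast
  then have j: "j \<in> swap_positions x" "w = swap0 x j"
    using x(1) by (auto simp: swap_positions_def ST2_verts_def)
  show thesis
  proof (cases "v = x")
    case True
    then show ?thesis using that x j by blast
  next
    case False
    then have v: "v = w"
      using x(3) assms(2) by simp
    \<comment> \<open>The swap at \<open>j\<close> undoes itself, so the edge can be read from its
      other end with the same position \<open>j\<close>.\<close>
    have "swap0 w j = x"
      using j by (simp add: swap0_swap0 swap_positions_def)
    then have "e = {v, swap0 v j}"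
      unfolding v x(3) by (simp add: insert_commute)
    moreover have "j \<in> swap_positions v"
      unfolding v j(2) using j(1) by (rule swap_positions_swap0)
    ultimately show ?thesis
      using that x(2) v by blast
  qed
qed

lemma swap0_edge:
  assumes "v \<in> ST2_verts k" "j \<in> swap_positions v"
  shows "{v, swap0 v j} \<in> ST2_edges k"
proof -
  have "ST2_adj k v (swap0 v j)"
    using assms by (auto simp: ST2_adj_def swap0_def swap_positions_def ST2_verts_def)
  moreover have "swap0 v j \<in> ST2_verts k"
    using assms by (auto simp: swap_positions_def swap0_in_ST2_verts)
  ultimately show ?thesis
    using assms unfolding ST2_edges_def by blast
qed

lemma neighbors_ST2:
  assumes "v \<in> ST2_verts k"
  shows "neighbors (ST2_verts k) (ST2_edges k) v = swap0 v ` swap_positions v"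
proof
  show "neighbors (ST2_verts k) (ST2_edges k) v \<subseteq> swap0 v ` swap_positions v"
  proof
    fix w assume "w \<in> neighbors (ST2_verts k) (ST2_edges k) v"
    then have "{v, w} \<in> ST2_edges k" by (simp add: neighbors_def)
    then obtain j where "j \<in> swap_positions v" "{v, w} = {v, swap0 v j}"
      by (rule ST2_edgeE[of _ _ v]) auto
    then show "w \<in> swap0 v ` swap_positions v"
      by (auto simp: doubleton_eq_iff)
  qed
  show "swap0 v ` swap_positions v \<subseteq> neighbors (ST2_verts k) (ST2_edges k) v"
    using assms swap0_edge swap0_in_ST2_verts
    by (auto simp: neighbors_def swap_positions_def)
qed

lemma bij_betw_color_neighbors:
  assumes "v \<in> ST2_verts k" "k > 0"
  shows "bij_betw (\<lambda>w. mate w 0) (neighbors (ST2_verts k) (ST2_edges k) v)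
    ({1..2 * k - 1} - {mate v 0})"
proof -
  have "bij_betw (mate v) (swap_positions v) ({1..2 * k - 1} - {mate v 0})"
    using bij_betw_mate[OF assms] swap_positions_eq_mate[OF assms] by simp
  then have "bij_betw (\<lambda>j. mate (swap0 v j) 0) (swap_positions v) ({1..2 * k - 1} - {mate v 0})"
    by (rule bij_betw_cong[THEN iffD1, rotated]) (simp add: mate_swap0[OF assms(1)])
  \<comment> \<open>The neighbours are the image of the swap positions under \<open>swap0 v\<close>;
    injectivity of the composite forces the colouring to be injective on that image.\<close>
  then show ?thesis
    unfolding neighbors_ST2[OF assms(1)] bij_betw_def inj_on_def by (auto simp: image_image)
qed

lemma mate0_in_colors:
  assumes "v \<in> ST2_verts k" "k > 0"
  shows "mate v 0 \<in> {1..2 * k - 1}"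
  using mate_less[OF assms(1), of 0] mate_neq[OF assms(1), of 0] assms by simp

section \<open>Regularity and the total colouring\<close>

lemma regular_ST2:
  assumes "k > 0"
  shows "regular_graph (ST2_verts k) (ST2_edges k) (2 * k - 2)"
  unfolding regular_graph_def
proof
  fix v assume v: "v \<in> ST2_verts k"
  note b = bij_betw_color_neighbors[OF v assms]
  \<comment> \<open>The degree is read off the colours: neighbours correspond to the 2k - 1 colours
    without that of \<open>v\<close>.\<close>
  show "finite (neighbors (ST2_verts k) (ST2_edges k) v) \<and>
      card (neighbors (ST2_verts k) (ST2_edges k) v) = 2 * k - 2"
    using bij_betw_finite[OF b] bij_betw_same_card[OF b] mate0_in_colors[OF v assms] by simp
qed

lemma total_coloring_ST2:
  assumes "k > 0"
  shows "total_coloring (ST2_verts k) (ST2_edges k) {1..2 * k - 1} (\<lambda>v. mate v 0) edge_position"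
  unfolding total_coloring_def
proof (intro conjI ballI impI)
  fix v assume "v \<in> ST2_verts k"
  then show "mate v 0 \<in> {1..2 * k - 1}"
    using assms by (rule mate0_in_colors)
next
  fix e assume e: "e \<in> ST2_edges k"
  then obtain v where "v \<in> e"
    by (auto simp: ST2_edges_def)
  with e obtain j where "v \<in> ST2_verts k" "j \<in> swap_positions v" "e = {v, swap0 v j}"
    by (rule ST2_edgeE)
  then show "edge_position e \<in> {1..2 * k - 1}"
    using swap_positions_eq_mate assms by (auto simp: edge_position_swap0)
next
  fix v w assume v: "v \<in> ST2_verts k" and w: "w \<in> ST2_verts k" "{v, w} \<in> ST2_edges k"
  then have "w \<in> neighbors (ST2_verts k) (ST2_edges k) v"
    by (simp add: neighbors_def)
  from bij_betw_apply[OF bij_betw_color_neighbors[OF v assms] this]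
  show "mate v 0 \<noteq> mate w 0"
    by auto
next
  fix e f assume ef: "e \<in> ST2_edges k" "f \<in> ST2_edges k" "e \<noteq> f \<and> e \<inter> f \<noteq> {}"
  then obtain v where v: "v \<in> e" "v \<in> f"
    by blast
  \<comment> \<open>Both edges are written from the common end \<open>v\<close>; equal positions
    would give the same swap and hence the same edge.\<close>
  obtain i where "i \<in> swap_positions v" "e = {v, swap0 v i}"
    using ef(1) v(1) by (rule ST2_edgeE)
  moreover obtain j where "j \<in> swap_positions v" "f = {v, swap0 v j}"
    using ef(2) v(2) by (rule ST2_edgeE)
  ultimately show "edge_position e \<noteq> edge_position f"
    using ef(3) by (auto simp: edge_position_swap0)
next
  \<comment> \<open>Seen from the end \<open>v\<close>, the edge colour is a swap position, and
    \<open>mate v 0\<close> is never one.\<close>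
  fix e v assume "e \<in> ST2_edges k" "v \<in> e"
  then obtain j where "v \<in> ST2_verts k" "j \<in> swap_positions v" "e = {v, swap0 v j}"
    by (rule ST2_edgeE)
  then show "edge_position e \<noteq> mate v 0"
    using swap_positions_eq_mate assms by (auto simp: edge_position_swap0)
qed

theorem theorem12:
  fixes k :: nat
  assumes "k > 1"
  shows "\<exists>(cv :: nat list \<Rightarrow> nat) (ce :: nat list set \<Rightarrow> nat).
     efficient_coloring (ST2_verts k) (ST2_edges k) (2 * k - 2) {1..2 * k - 1} cv ce \<and>
     (\<forall>i\<in>{1..2 * k - 1}. {v \<in> ST2_verts k. cv v = i} = Sigma_class k i) \<and>
     (\<forall>v\<in>ST2_verts k. inj_on cv (insert v (neighbors (ST2_verts k) (ST2_edges k) v)))"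
proof (rule exI[where x = "\<lambda>v. mate v 0"], rule exI[where x = edge_position],
    intro conjI ballI)
  have k: "k > 0"
    using assms by simp
  \<comment> \<open>The neighbours supply every colour except \<open>mate v 0\<close>, which
    \<open>v\<close> itself supplies.\<close>
  have "(\<lambda>v. mate v 0) ` insert v (neighbors (ST2_verts k) (ST2_edges k) v) = {1..2 * k - 1}"
    if v: "v \<in> ST2_verts k" for v
    unfolding image_insert bij_betw_imp_surj_on[OF bij_betw_color_neighbors[OF v k]]
    using mate0_in_colors[OF v k] by (simp only: insert_Diff_single insert_absorb)
  then show "efficient_coloring (ST2_verts k) (ST2_edges k) (2 * k - 2) {1..2 * k - 1}
      (\<lambda>v. mate v 0) edge_position"
    using assms regular_ST2[OF k] total_coloring_ST2[OF k] by (simp add: efficient_coloring_def)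
  show "{v \<in> ST2_verts k. mate v 0 = i} = Sigma_class k i" if i: "i \<in> {1..2 * k - 1}" for i
  proof -
    have "mate v 0 = i \<longleftrightarrow> v ! i = v ! 0" if "v \<in> ST2_verts k" for v
      using that i k mate_eqI[of v k 0 i] nth_mate[of v k 0] by auto
    then show ?thesis
      by (auto simp: Sigma_class_def)
  qed
  \<comment> \<open>The colour of \<open>v\<close> is missing among its neighbours, so injectivity
    there extends to \<open>v\<close>.\<close>
  show "inj_on (\<lambda>v. mate v 0) (insert v (neighbors (ST2_verts k) (ST2_edges k) v))"
    if v: "v \<in> ST2_verts k" for v
    using bij_betw_color_neighbors[OF v k] by (auto simp: bij_betw_def)
qed

end
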